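(* Let $(p,F)$ be a generating pair, where $F=\{f_1,\dots,f_N\}$, $N\ge 2$. Then there exist infinitely many $\theta\in[N]^{\omega}$ for which $T(\theta)=T(p,F,\theta)$ is a self-similar polygonal tiling.
   Context: Polygons are closed plane regions with non-crossing (except at vertices) sides and positive area. Two sets are called disjoint if they intersect only at a subset of their boundaries; $\bigsqcup$ denotes a union that is pairwise disjoint in this sense. A similitude of the plane with scaling ratio $r>0$ is a map $f:\mathbb{R}^2\to\mathbb{R}^2$ with $|f(x)-f(y)|=r|x-y|$ for all $x,y$. Generating pair: a pair $(p,F)$ where $p$ is a polygon and $F=\{f_1,\dots,f_N\}$, $N\ge2$, is a set of similitudes of the plane with scaling ratios $r_1,\dots,r_N$ such that there exist a real number $0<s<1$ and positive integers $a_1,\dots,a_N$ with $p=\bigsqcup_{n=1}^N f_n(p)$ and $r_n=s^{a_n}$ for $n=1,\dots,N$. Notation: $[N]=\{1,\dots,N\}$; $[N]^*$ is the set of finite strings over $[N]$, and $[N]^{\omega}$ the set of infinite strings over $[N]$. For $\sigma=\sigma_1\cdots\sigma_m\in[N]^*$ let $e(\sigma)=\sum_{i=1}^{m}a_{\sigma_i}$, $e^-(\sigma)=\sum_{i=1}^{m-1}a_{\sigma_i}$, $f_\sigma=f_{\sigma_1}\circ f_{\sigma_2}\circ\cdots\circ f_{\sigma_m}$, $f_{-\sigma}=f_{\sigma_1}^{-1}\circ f_{\sigma_2}^{-1}\circ\cdots\circ f_{\sigma_m}^{-1}$. For $\theta\in[N]^\omega$, $\theta|k=\theta_1\cdots\theta_k$.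 The $\theta$-tiling: for $\theta\in[N]^\omega$, $k\ge1$, $\sigma\in[N]^*$ set $t(\theta,k,\sigma)=(f_{-(\theta|k)}\circ f_\sigma)(p)$, $T(\theta,k)=\{t(\theta,k,\sigma): e(\sigma)\ge e(\theta|k)>e^-(\sigma)\}$, and $T(\theta)=T(p,F,\theta)=\bigcup_{k\ge1}T(\theta,k)$ (a nested union of sets of tiles). A tiling of the plane is a set of pairwise disjoint (in the sense that any two of them intersect only at a subset of their boundaries) compact sets, called tiles, whose union is the plane. A tiling is of finite order if its tiles fall into finitely many congruence classes. A tiling $T$ is self-similar if there is a similitude $\phi$ with scaling ratio $>1$ such that for every $t\in T$ the set $\phi(t)$ is the disjoint union of tiles in $T$. A patch of $T$ is a subset of $T$ whose union is a (closed) topological disk. $T$ is quasiperiodic if for every patch $U$ there is $R>0$ such that any disk of radius $R$ contains, up to congruence, a copy of $U$ (i.e. a set of tiles of $T$ contained in the disk that is the image of $U$ under a Euclidean motion). A self-similar polygonal tiling is a tiling of the plane by pairwise similar polygons that is (1) self-similar, (2) quasiperiodic, and (3) of finite order. *)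

theory Defs
  imports "HOL-Analysis.Analysis" "HOL-Library.Stream"
begin

type_synonym plane = "real ^ 2"

definition similitude :: "real \<Rightarrow> (plane \<Rightarrow> plane) \<Rightarrow> bool" where
  "similitude r f \<longleftrightarrow> r > 0 \<and> (\<forall>x y. dist (f x) (f y) = r * dist x y)"

text \<open>Euclidean motions are the similitudes of ratio 1, so reflections are allowed.\<close>

definition congruent_sets :: "plane set \<Rightarrow> plane set \<Rightarrow> bool" where
  "congruent_sets A B \<longleftrightarrow> (\<exists>g. similitude 1 g \<and> B = g ` A)"

definition similar_sets :: "plane set \<Rightarrow> plane set \<Rightarrow> bool" where
  "similar_sets A B \<longleftrightarrow> (\<exists>r g. similitude r g \<and> B = g ` A)"

definition bdry_disjnt :: "plane set \<Rightarrow> plane set \<Rightarrow> bool" where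
  "bdry_disjnt A B \<longleftrightarrow> A \<inter> B \<subseteq> frontier A \<inter> frontier B"

definition side :: "plane list \<Rightarrow> nat \<Rightarrow> plane set" where
  "side vs i = closed_segment (vs ! i) (vs ! (Suc i mod length vs))"

text \<open>The sides form a closed chain and two of them meet only at vertices. The list of vertices
  may have repetitions, so the chain may touch itself at a vertex; if it does not, it is a Jordan
  curve and the conditions on \<^term>\<open>p\<close> say that \<^term>\<open>p\<close> is this curve together with its inside.\<close>

definition polygon :: "plane set \<Rightarrow> bool" where
  "polygon p \<longleftrightarrow>
     compact p \<and> closure (interior p) = p \<and> measure lebesgue p > 0 \<and>
     (\<exists>vs. 3 \<le> length vs \<and>
        (\<forall>i < length vs. vs ! i \<noteq> vs ! (Suc i mod length vs)) \<and>
        (\<forall>i < length vs. \<forall>j < length vs. i \<noteq> j \<longrightarrow> side vs i \<inter> side vs j \<subseteq> set vs) \<and>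
        frontier p = (\<Union>i < length vs. side vs i))"

text \<open>The data \<^term>\<open>s\<close> and \<^term>\<open>a\<close>, whose existence makes \<^term>\<open>(p, f ` {1..N})\<close> a generating
  pair, are arguments because the exponents enter the definition of the tilings below.\<close>

definition generating_pair ::
  "plane set \<Rightarrow> nat \<Rightarrow> (nat \<Rightarrow> plane \<Rightarrow> plane) \<Rightarrow> real \<Rightarrow> (nat \<Rightarrow> nat) \<Rightarrow> bool" where
  "generating_pair p N f s a \<longleftrightarrow>
     polygon p \<and> 2 \<le> N \<and> 0 < s \<and> s < 1 \<and>
     (\<forall>n\<in>{1..N}. 0 < a n \<and> similitude (s ^ a n) (f n)) \<and>
     p = (\<Union>n\<in>{1..N}. f n ` p) \<and>
     (\<forall>m\<in>{1..N}. \<forall>n\<in>{1..N}. m \<noteq> n \<longrightarrow> bdry_disjnt (f m ` p) (f n ` p))"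

definition str_exp :: "(nat \<Rightarrow> nat) \<Rightarrow> nat list \<Rightarrow> nat" where
  "str_exp a \<sigma> = sum_list (map a \<sigma>)"

definition str_exp_minus :: "(nat \<Rightarrow> nat) \<Rightarrow> nat list \<Rightarrow> nat" where
  "str_exp_minus a \<sigma> = sum_list (map a (butlast \<sigma>))"

definition str_map :: "(nat \<Rightarrow> plane \<Rightarrow> plane) \<Rightarrow> nat list \<Rightarrow> plane \<Rightarrow> plane" where
  "str_map f \<sigma> = foldr (\<circ>) (map f \<sigma>) id"

text \<open>The inverses are composed in the order of the string, so this is in general not the inverse
  of \<^term>\<open>str_map f \<sigma>\<close>.\<close>

definition str_map_neg :: "(nat \<Rightarrow> plane \<Rightarrow> plane) \<Rightarrow> nat list \<Rightarrow> plane \<Rightarrow> plane" where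
  "str_map_neg f \<sigma> = foldr (\<circ>) (map (\<lambda>i. inv (f i)) \<sigma>) id"

definition tile ::
  "plane set \<Rightarrow> (nat \<Rightarrow> plane \<Rightarrow> plane) \<Rightarrow> nat stream \<Rightarrow> nat \<Rightarrow> nat list \<Rightarrow> plane set" where
  "tile p f \<theta> k \<sigma> = (str_map_neg f (stake k \<theta>) \<circ> str_map f \<sigma>) ` p"

definition theta_tiling_upto ::
  "plane set \<Rightarrow> nat \<Rightarrow> (nat \<Rightarrow> plane \<Rightarrow> plane) \<Rightarrow> (nat \<Rightarrow> nat) \<Rightarrow> nat stream \<Rightarrow> nat \<Rightarrow> plane set set"
  where
  "theta_tiling_upto p N f a \<theta> k =
     {tile p f \<theta> k \<sigma> | \<sigma>. \<sigma> \<in> lists {1..N} \<and>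
        str_exp a \<sigma> \<ge> str_exp a (stake k \<theta>) \<and> str_exp a (stake k \<theta>) > str_exp_minus a \<sigma>}"

definition theta_tiling ::
  "plane set \<Rightarrow> nat \<Rightarrow> (nat \<Rightarrow> plane \<Rightarrow> plane) \<Rightarrow> (nat \<Rightarrow> nat) \<Rightarrow> nat stream \<Rightarrow> plane set set"
  where
  "theta_tiling p N f a \<theta> = (\<Union>k\<in>{1..}. theta_tiling_upto p N f a \<theta> k)"

definition plane_tiling :: "plane set set \<Rightarrow> bool" where
  "plane_tiling T \<longleftrightarrow> (\<forall>t\<in>T. compact t) \<and> pairwise bdry_disjnt T \<and> \<Union>T = UNIV"

definition finite_order :: "plane set set \<Rightarrow> bool" where
  "finite_order T \<longleftrightarrow> finite (T // {(t, u). t \<in> T \<and> u \<in> T \<and> congruent_sets t u})"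

definition self_similar :: "plane set set \<Rightarrow> bool" where
  "self_similar T \<longleftrightarrow>
     (\<exists>r \<phi>. r > 1 \<and> similitude r \<phi> \<and>
        (\<forall>t\<in>T. \<exists>S. S \<subseteq> T \<and> pairwise bdry_disjnt S \<and> \<phi> ` t = \<Union>S))"

definition patch :: "plane set set \<Rightarrow> plane set set \<Rightarrow> bool" where
  "patch T U \<longleftrightarrow> U \<subseteq> T \<and> \<Union>U homeomorphic cball (0 :: plane) 1"

definition quasiperiodic :: "plane set set \<Rightarrow> bool" where
  "quasiperiodic T \<longleftrightarrow>
     (\<forall>U. patch T U \<longrightarrow>
        (\<exists>R>0. \<forall>x. \<exists>g. similitude 1 g \<and> (\<lambda>t. g ` t) ` U \<subseteq> T \<and> (\<forall>t\<in>U. g ` t \<subseteq> cball x R)))"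

definition self_similar_polygonal_tiling :: "plane set set \<Rightarrow> bool" where
  "self_similar_polygonal_tiling T \<longleftrightarrow>
     plane_tiling T \<and> (\<forall>t\<in>T. polygon t) \<and> (\<forall>t\<in>T. \<forall>u\<in>T. similar_sets t u) \<and>
     self_similar T \<and> quasiperiodic T \<and> finite_order T"

end

theory Submission
  imports Defs
begin

text \<open>The pieces \<open>f\<^sub>\<sigma>(p)\<close> cover \<open>p\<close> and become arbitrarily small, so some string \<open>\<sigma>\<close> has
  \<open>f\<^sub>\<sigma>(p)\<close> inside the interior of \<open>p\<close> (\<open>ex_piece_subset_interior\<close>). Every string \<open>v\<close> that begins
  with \<open>\<sigma>\<close> inherits this, and for each such \<open>v\<close> the periodic string \<open>\<theta>\<close> whose period is the
  reversal of \<open>v\<close> gives a self-similar polygonal tiling. The strings \<open>v = \<sigma> 2 1\<dots>1\<close> give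
  infinitely many \<open>\<theta>\<close>.

  Put \<open>g = f\<^sub>v\<close>, let \<open>h\<close> be the inverse of \<open>g\<close>, and \<open>K = e(v)\<close>. The map that the definition of
  \<open>T(\<theta>)\<close> attaches to a prefix of \<open>\<theta>\<close> composes the inverses in the order of the prefix; because of
  the reversal it is \<open>h\<^sup>m\<close> after \<open>m\<close> periods. Hence \<open>T(\<theta>)\<close> is the increasing union of the
  sets \<open>h\<^sup>m(C\<^sub>m)\<close>, where \<open>C\<^sub>m\<close> is the dissection of \<open>p\<close> into the pieces \<open>f\<^sub>\<tau>(p)\<close> with
  \<open>e(\<tau>) \<ge> m K\<close> for which \<open>\<tau>\<close> without its last letter has exponent below \<open>m K\<close>.

  The fixed point of \<open>g\<close> lies in the interior of \<open>p\<close>, so the sets \<open>h\<^sup>m(p)\<close> exhaust the plane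
  (\<open>bounded_subset_blowup\<close>) and \<open>T(\<theta>)\<close> is a tiling of the plane. The scaling ratio of a tile is
  \<open>s\<^sup>d\<close> with \<open>d\<close> from a bounded range of natural numbers, so there are finitely many congruence
  classes. The map \<open>h\<close> is a self-similarity, because cut sets at larger exponents refine those at
  smaller ones (\<open>piece_refine\<close>).

  For quasiperiodicity, a set of tiles with bounded union lies in a single \<open>h\<^sup>m(C\<^sub>m)\<close>
  (\<open>bounded_subset_level\<close>). If \<open>e(\<sigma>) = (n - m) K\<close>, then \<open>h\<^sup>n f\<^sub>\<sigma> g\<^sup>m\<close> is an isometry that maps
  \<open>h\<^sup>m(C\<^sub>m)\<close> into \<open>h\<^sup>n(C\<^sub>n)\<close>. Near any given point there is such a \<open>\<sigma>\<close>: a string \<open>\<rho>\<close> that locates the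
  point has \<open>e(\<rho>)\<close> only approximately right, but a suffix of bounded exponent makes the exponent a
  multiple of \<open>K\<close> (\<open>complete_exponent_mod\<close>), and copies of \<open>v\<close> then supply the rest
  (\<open>level_recurrence\<close>).\<close>

section \<open>Similitudes of the plane\<close>

text \<open>After the value at the origin is subtracted, a similitude fixes the origin, and a map that fixes
  the origin and scales all distances by the same factor is linear.\<close>

lemma similitude_affine:
  assumes "similitude r f"
  obtains c L where "linear L" "inj L" "f = (\<lambda>x. c + L x)"
proof
  have r: "r > 0" and d: "\<And>x y. dist (f x) (f y) = r * dist x y"
    using assms by (auto simp: similitude_def)
  show "linear (\<lambda>x. f x - f 0)"
    by (rule scaling_linear[where c = r]) (use d in \<open>auto simp: dist_norm\<close>)
  show "inj (\<lambda>x. f x - f 0)"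
  proof (rule injI)
    fix x y assume "f x - f 0 = f y - f 0"
    then have "dist (f x) (f y) = 0" by simp
    then show "x = y" using r by (simp add: d)
  qed
  show "f = (\<lambda>x. f 0 + (f x - f 0))" by simp
qed

lemma similitude_bij: "similitude r f \<Longrightarrow> bij f"
proof (erule similitude_affine)
  fix c L assume L: "linear L" "inj (L :: plane \<Rightarrow> plane)" "f = (\<lambda>x. c + L x)"
  then have "bij L" by (simp add: bij_def linear_injective_imp_surjective)
  moreover have "f = (\<lambda>x. c + x) \<circ> L" using L by auto
  moreover have "bij (\<lambda>x. c + x)" by (simp add: bij_def surj_plus)
  ultimately show "bij f" by (auto intro: bij_comp)
qed

lemma similitude_compose:
  "similitude q f \<Longrightarrow> similitude r g \<Longrightarrow> similitude (q * r) (f \<circ> g)"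
  by (auto simp: similitude_def)

lemma similitude_id: "similitude 1 id"
  by (auto simp: similitude_def)

lemma similitude_inv:
  assumes "similitude r f"
  shows "similitude (1 / r) (inv f)"
  unfolding similitude_def
proof (intro conjI allI)
  show "1 / r > 0" using assms by (simp add: similitude_def)
  fix x y
  have "dist (f (inv f x)) (f (inv f y)) = r * dist (inv f x) (inv f y)"
    using assms by (simp add: similitude_def)
  then show "dist (inv f x) (inv f y) = 1 / r * dist x y"
    using assms similitude_bij[OF assms]
    by (simp add: similitude_def bij_is_surj surj_f_inv_f field_simps)
qed

lemma similitude_funpow: "similitude r f \<Longrightarrow> similitude (r ^ n) (f ^^ n)"
  by (induction n) (auto simp: similitude_def)

lemma similitude_interior_closure_frontier:
  assumes "similitude r f"
  shows "interior (f ` A) = f ` interior A" "closure (f ` A) = f ` closure A"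
    "frontier (f ` A) = f ` frontier A"
proof -
  obtain c L where L: "linear L" "inj (L :: plane \<Rightarrow> plane)" "f = (\<lambda>x. c + L x)"
    using assms by (rule similitude_affine)
  have im: "f ` X = (\<lambda>x. c + x) ` L ` X" for X
    by (simp add: L(3) image_image)
  show i: "interior (f ` A) = f ` interior A"
    using L by (metis im interior_translation interior_injective_linear_image)
  show c: "closure (f ` A) = f ` closure A"
    using L by (metis im closure_translation closure_injective_linear_image)
  show "frontier (f ` A) = f ` frontier A"
    using bij_is_inj[OF similitude_bij[OF assms]]
    by (simp add: frontier_def i c image_set_diff)
qed

lemma similitude_closed_segment:
  assumes "similitude r f"
  shows "closed_segment (f x) (f y) = f ` closed_segment x y"
proof -
  obtain c L where L: "linear L" "inj (L :: plane \<Rightarrow> plane)" "f = (\<lambda>x. c + L x)"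
    using assms by (rule similitude_affine)
  show ?thesis
    using L by (simp add: closed_segment_translation closed_segment_linear_image image_image)
qed

lemma similitude_compact:
  assumes "similitude r f" "compact A"
  shows "compact (f ` A)"
proof (rule compact_continuous_image)
  obtain c L where L: "linear L" "inj (L :: plane \<Rightarrow> plane)" "f = (\<lambda>x. c + L x)"
    using assms(1) by (rule similitude_affine)
  then show "continuous_on A f"
    by (simp add: continuous_on_add linear_continuous_on linear_conv_bounded_linear)
qed (fact assms)

lemma bdry_disjnt_image:
  assumes "similitude r f" "bdry_disjnt A B"
  shows "bdry_disjnt (f ` A) (f ` B)"
proof -
  have "f ` A \<inter> f ` B = f ` (A \<inter> B)"
    using bij_is_inj[OF similitude_bij[OF assms(1)]] by (simp add: image_Int)
  then show ?thesis
    using assms(2) by (auto simp: bdry_disjnt_def similitude_interior_closure_frontier[OF assms(1)])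
qed

text \<open>A common point of the smaller sets is a boundary point of the larger ones, so it is interior to
  neither of the smaller ones.\<close>

lemma bdry_disjnt_subset:
  assumes "bdry_disjnt A B" "A' \<subseteq> A" "B' \<subseteq> B"
  shows "bdry_disjnt A' B'"
  unfolding bdry_disjnt_def
proof
  fix x assume x: "x \<in> A' \<inter> B'"
  then have "x \<in> frontier A" "x \<in> frontier B"
    using assms by (auto simp: bdry_disjnt_def)
  then have "x \<notin> interior A'" "x \<notin> interior B'"
    using interior_mono[OF assms(2)] interior_mono[OF assms(3)] by (auto simp: frontier_def)
  moreover have "x \<in> closure A'" "x \<in> closure B'"
    using x closure_subset by auto
  ultimately show "x \<in> frontier A' \<inter> frontier B'"
    by (auto simp: frontier_def)
qed

lemma polygon_interior_nonempty: "polygon p \<Longrightarrow> interior p \<noteq> {}"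
proof
  assume p: "polygon p" "interior p = {}"
  then have "p = {}" by (metis polygon_def closure_empty)
  with p(1) show False by (simp add: polygon_def)
qed

text \<open>The area of the image is positive because a set with an interior point is not negligible. The
  images of the vertices serve as vertices, since similitudes carry segments to segments.\<close>

lemma polygon_similitude_image:
  assumes f: "similitude r f" and p: "polygon p"
  shows "polygon (f ` p)"
  unfolding polygon_def
proof (intro conjI)
  note top = similitude_interior_closure_frontier[OF f]
  have inj: "inj f" using similitude_bij[OF f] by (rule bij_is_inj)
  show c: "compact (f ` p)"
    using similitude_compact[OF f] p by (simp add: polygon_def)
  show "closure (interior (f ` p)) = f ` p"
    using p by (simp add: top polygon_def)
  have "\<not> negligible (interior (f ` p))"
    using polygon_interior_nonempty[OF p] by (intro open_not_negligible open_interior) (simp add: top)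
  then have "\<not> negligible (f ` p)"
    using interior_subset negligible_subset by blast
  then show "measure lebesgue (f ` p) > 0"
    using lmeasurable_compact[OF c] by (simp add: negligible_iff_measure0 zero_less_measure_iff)
  obtain vs where vs: "3 \<le> length vs"
      "\<And>i. i < length vs \<Longrightarrow> vs ! i \<noteq> vs ! (Suc i mod length vs)"
      "\<And>i j. i < length vs \<Longrightarrow> j < length vs \<Longrightarrow> i \<noteq> j \<Longrightarrow> side vs i \<inter> side vs j \<subseteq> set vs"
      "frontier p = (\<Union>i < length vs. side vs i)"
    using p unfolding polygon_def by (elim conjE exE) (rule that; blast)
  have m: "Suc i mod length vs < length vs" for i
    using vs(1) by (intro mod_less_divisor) linarith
  have sd: "side (map f vs) i = f ` side vs i" if "i < length vs" for i
    using that m by (simp add: side_def similitude_closed_segment[OF f])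
  show "\<exists>vs. 3 \<le> length vs \<and>
        (\<forall>i < length vs. vs ! i \<noteq> vs ! (Suc i mod length vs)) \<and>
        (\<forall>i < length vs. \<forall>j < length vs. i \<noteq> j \<longrightarrow> side vs i \<inter> side vs j \<subseteq> set vs) \<and>
        frontier (f ` p) = (\<Union>i < length vs. side vs i)"
  proof (rule exI[of _ "map f vs"], intro conjI allI impI)
    show "3 \<le> length (map f vs)" using vs(1) by simp
  next
    fix i assume "i < length (map f vs)"
    then show "map f vs ! i \<noteq> map f vs ! (Suc i mod length (map f vs))"
      using vs(2)[of i] m inj by (simp add: inj_eq)
  next
    fix i j assume "i < length (map f vs)" "j < length (map f vs)" "i \<noteq> j"
    then show "side (map f vs) i \<inter> side (map f vs) j \<subseteq> set (map f vs)"
      using vs(3)[of i j] by (auto simp: sd image_Int[OF inj, symmetric])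
  next
    show "frontier (f ` p) = (\<Union>i < length (map f vs). side (map f vs) i)"
      by (simp add: top vs(4) image_UN sd)
  qed
qed

section \<open>Exponents and maps of strings\<close>

lemma str_exp_simps [simp]:
  "str_exp a [] = 0" "str_exp a (i # \<sigma>) = a i + str_exp a \<sigma>"
  "str_exp a (\<sigma> @ \<tau>) = str_exp a \<sigma> + str_exp a \<tau>" "str_exp a (rev \<sigma>) = str_exp a \<sigma>"
  by (auto simp: str_exp_def rev_map[symmetric] sum_list_rev)

lemma str_exp_concat_replicate [simp]: "str_exp a (concat (replicate n \<sigma>)) = n * str_exp a \<sigma>"
  by (induction n) auto

lemma str_map_simps [simp]:
  "str_map f [] = id" "str_map f (i # \<sigma>) = f i \<circ> str_map f \<sigma>"
  "str_map f (\<sigma> @ \<tau>) = str_map f \<sigma> \<circ> str_map f \<tau>"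
  by (auto simp: str_map_def) (induction \<sigma>; auto)

lemma str_map_neg_simps [simp]:
  "str_map_neg f [] = id" "str_map_neg f (i # \<sigma>) = inv (f i) \<circ> str_map_neg f \<sigma>"
  "str_map_neg f (\<sigma> @ \<tau>) = str_map_neg f \<sigma> \<circ> str_map_neg f \<tau>"
  by (auto simp: str_map_neg_def) (induction \<sigma>; auto)

lemma str_map_neg_concat_replicate:
  "str_map_neg f (concat (replicate n \<sigma>)) = str_map_neg f \<sigma> ^^ n"
  by (induction n) auto

section \<open>Cut sets of strings\<close>

locale self_similar_polygon =
  fixes p :: "plane set" and N :: nat and f :: "nat \<Rightarrow> plane \<Rightarrow> plane"
    and s :: real and a :: "nat \<Rightarrow> nat"
  assumes gen: "generating_pair p N f s a"
begin

lemma
  shows poly: "polygon p" and N_ge: "2 \<le> N" and s_pos: "0 < s" and s_lt_1: "s < 1"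
    and a_pos: "n \<in> {1..N} \<Longrightarrow> 0 < a n" and sim: "n \<in> {1..N} \<Longrightarrow> similitude (s ^ a n) (f n)"
    and p_eq: "p = (\<Union>n\<in>{1..N}. f n ` p)"
    and p_disj: "m \<in> {1..N} \<Longrightarrow> n \<in> {1..N} \<Longrightarrow> m \<noteq> n \<Longrightarrow> bdry_disjnt (f m ` p) (f n ` p)"
  using gen unfolding generating_pair_def by auto

text \<open>For \<open>l > 0\<close> these are the strings at which the exponent first reaches \<open>l\<close>. Every infinite string
  over \<open>{1..N}\<close> has exactly one of them as a prefix, so their pieces dissect \<open>p\<close>.\<close>

definition cut :: "nat \<Rightarrow> nat list set" where
  "cut l = {\<sigma> \<in> lists {1..N}. str_exp_minus a \<sigma> < l \<and> l \<le> str_exp a \<sigma>}"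

definition piece :: "nat list \<Rightarrow> plane set" where
  "piece \<sigma> = str_map f \<sigma> ` p"

lemma compact_p: "compact p" using poly by (simp add: polygon_def)

lemma str_map_similitude: "\<sigma> \<in> lists {1..N} \<Longrightarrow> similitude (s ^ str_exp a \<sigma>) (str_map f \<sigma>)"
proof (induction \<sigma>)
  case Nil
  then show ?case by (metis similitude_id str_map_simps(1) str_exp_simps(1) power_0)
next
  case (Cons i \<sigma>)
  then show ?case
    unfolding str_map_simps str_exp_simps power_add
    by (intro similitude_compose sim Cons.IH) auto
qed

lemma str_map_neg_rev:
  "\<sigma> \<in> lists {1..N} \<Longrightarrow> str_map_neg f (rev \<sigma>) = inv (str_map f \<sigma>)"
proof (induction \<sigma>)
  case (Cons i \<sigma>)
  then have "bij (f i)" "bij (str_map f \<sigma>)"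
    using sim str_map_similitude similitude_bij by (meson Cons_in_lists_iff)+
  moreover have "str_map_neg f (rev \<sigma>) = inv (str_map f \<sigma>)" using Cons by simp
  ultimately show ?case
    by (simp only: rev.simps str_map_simps str_map_neg_simps comp_id o_inv_distrib)
qed simp

lemma piece_append: "piece (\<sigma> @ \<tau>) = str_map f \<sigma> ` piece \<tau>"
  by (simp add: piece_def image_comp)

lemma str_map_image_subset: "\<sigma> \<in> lists {1..N} \<Longrightarrow> str_map f \<sigma> ` p \<subseteq> p"
proof (induction \<sigma>)
  case (Cons i \<sigma>)
  then have "f i ` str_map f \<sigma> ` p \<subseteq> f i ` p" by (intro image_mono) auto
  also have "f i ` p \<subseteq> p" using Cons.prems by (subst (2) p_eq) auto
  finally show ?case by (simp add: image_comp)
qed simp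

lemma piece_append_subset: "\<tau> \<in> lists {1..N} \<Longrightarrow> piece (\<sigma> @ \<tau>) \<subseteq> piece \<sigma>"
  using str_map_image_subset[of \<tau>] unfolding piece_append by (simp add: piece_def image_mono)

lemma piece_dist:
  assumes "\<sigma> \<in> lists {1..N}" "x \<in> piece \<sigma>" "y \<in> piece \<sigma>"
  shows "dist x y \<le> s ^ str_exp a \<sigma> * diameter p"
proof -
  obtain u v where "u \<in> p" "v \<in> p" "x = str_map f \<sigma> u" "y = str_map f \<sigma> v"
    using assms by (auto simp: piece_def)
  then show ?thesis
    using str_map_similitude[OF assms(1)] s_pos
      diameter_bounded_bound[OF compact_imp_bounded[OF compact_p], of u v]
    by (simp add: similitude_def mult_left_mono)
qed

text \<open>This recursion on the first letter drives the inductions about cut sets.\<close>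

lemma cut_Cons:
  assumes "0 < l"
  shows "i # \<sigma> \<in> cut l \<longleftrightarrow>
    i \<in> {1..N} \<and> (\<sigma> = [] \<and> l \<le> a i \<or> a i < l \<and> \<sigma> \<in> cut (l - a i))"
  using assms by (cases \<sigma>) (auto simp: cut_def str_exp_minus_def str_exp_def)

lemma Nil_notin_cut: "0 < l \<Longrightarrow> [] \<notin> cut l"
  by (simp add: cut_def)

lemma cut_append:
  assumes "\<sigma> \<in> lists {1..N}" "0 < l" "\<tau> \<in> cut l"
  shows "\<sigma> @ \<tau> \<in> cut (str_exp a \<sigma> + l)"
  using assms(1) by (induction \<sigma>) (auto simp: cut_Cons assms)

lemma cut_lists: "\<sigma> \<in> cut l \<Longrightarrow> \<sigma> \<in> lists {1..N}"
  by (simp add: cut_def)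

text \<open>Before its last letter the exponent of \<open>\<sigma>\<close> is below \<open>l\<close>, and the sum over all letters bounds
  the exponent of that letter.\<close>

lemma cut_str_exp_less:
  assumes "\<sigma> \<in> cut l" "0 < l"
  shows "str_exp a \<sigma> < l + (\<Sum>n\<in>{1..N}. a n)"
proof -
  have ne: "\<sigma> \<noteq> []" using assms Nil_notin_cut by auto
  then have "str_exp a \<sigma> = str_exp_minus a \<sigma> + a (last \<sigma>)"
    by (metis append_butlast_last_id str_exp_simps(1,2,3) str_exp_def str_exp_minus_def add_0_right)
  moreover have "last \<sigma> \<in> {1..N}"
    using cut_lists[OF assms(1)] ne last_in_set by (auto simp: in_lists_conv_set)
  then have "a (last \<sigma>) \<le> (\<Sum>n\<in>{1..N}. a n)"
    by (intro member_le_sum) auto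
  ultimately show ?thesis using assms(1) by (simp add: cut_def)
qed

lemma cut_cover:
  assumes "x \<in> p" "0 < l"
  shows "\<exists>\<sigma>\<in>cut l. x \<in> piece \<sigma>"
  using assms
proof (induction l arbitrary: x rule: less_induct)
  case (less l)
  then obtain i y where i: "i \<in> {1..N}" and y: "y \<in> p" "x = f i y"
    using p_eq by blast
  show ?case
  proof (cases "l \<le> a i")
    case True
    then have "[i] \<in> cut l" using i less by (simp add: cut_Cons)
    moreover have "x \<in> piece [i]" using y by (simp add: piece_def)
    ultimately show ?thesis by blast
  next
    case False
    then obtain \<sigma> where "\<sigma> \<in> cut (l - a i)" "y \<in> piece \<sigma>"
      using less.IH[of "l - a i" y] a_pos[OF i] y by auto
    then have "i # \<sigma> \<in> cut l" "x \<in> piece (i # \<sigma>)"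
      using False i y less.prems by (auto simp: cut_Cons piece_def)
    then show ?thesis by blast
  qed
qed

text \<open>Two members of a cut set are not prefixes of each other. At the first position where they
  differ, they enter two of the sets \<open>f i ` p\<close>, which meet only in boundary points.\<close>

lemma cut_bdry_disjnt:
  assumes "\<sigma> \<in> cut l" "\<tau> \<in> cut l" "0 < l" "\<sigma> \<noteq> \<tau>"
  shows "bdry_disjnt (piece \<sigma>) (piece \<tau>)"
  using assms
proof (induction \<sigma> arbitrary: \<tau> l)
  case Nil
  then show ?case using Nil_notin_cut by blast
next
  case (Cons i \<sigma>)
  then obtain j \<tau>' where \<tau>: "\<tau> = j # \<tau>'"
    using Nil_notin_cut by (cases \<tau>) auto
  have ij: "i \<in> {1..N}" "j \<in> {1..N}" using Cons.prems \<tau> by (auto simp: cut_Cons)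
  show ?case
  proof (cases "i = j")
    case True
    then have "\<sigma> \<in> cut (l - a i)" "\<tau>' \<in> cut (l - a i)" "0 < l - a i" "\<sigma> \<noteq> \<tau>'"
      using Cons.prems \<tau> by (auto simp: cut_Cons)
    then have "bdry_disjnt (piece \<sigma>) (piece \<tau>')" by (rule Cons.IH)
    then have "bdry_disjnt (f i ` piece \<sigma>) (f i ` piece \<tau>')"
      using bdry_disjnt_image sim ij by blast
    then show ?thesis using \<tau> True by (simp add: piece_def image_comp)
  next
    case False
    have sub: "piece (k # \<rho>) \<subseteq> f k ` p" if "\<rho> \<in> lists {1..N}" for k \<rho>
      using piece_append_subset[OF that, of "[k]"] by (simp add: piece_def)
    have "\<sigma> \<in> lists {1..N}" "\<tau>' \<in> lists {1..N}"
      using Cons.prems \<tau> cut_lists by (metis Cons_in_lists_iff)+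
    then show ?thesis
      unfolding \<tau> by (intro bdry_disjnt_subset[OF p_disj[OF ij False]] sub)
  qed
qed

text \<open>Either the exponent of \<open>\<sigma>\<close> has already reached \<open>l'\<close>, and then \<open>\<sigma>\<close> itself belongs to the finer
  cut set, or the remaining exponent is positive and the cut set at that exponent dissects \<open>p\<close>.\<close>

lemma piece_refine:
  assumes "0 < l" "l \<le> l'" "\<sigma> \<in> cut l"
  shows "piece \<sigma> = \<Union> (piece ` {\<tau> \<in> cut l'. \<exists>\<xi>. \<tau> = \<sigma> @ \<xi>})"
proof
  have "\<xi> \<in> lists {1..N}" if "\<sigma> @ \<xi> \<in> cut l'" for \<xi>
    using cut_lists[OF that] by auto
  then show "\<Union> (piece ` {\<tau> \<in> cut l'. \<exists>\<xi>. \<tau> = \<sigma> @ \<xi>}) \<subseteq> piece \<sigma>"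
    using piece_append_subset by blast
  show "piece \<sigma> \<subseteq> \<Union> (piece ` {\<tau> \<in> cut l'. \<exists>\<xi>. \<tau> = \<sigma> @ \<xi>})"
  proof (cases "l' \<le> str_exp a \<sigma>")
    case True
    then have "\<sigma> \<in> cut l'" using assms by (auto simp: cut_def)
    then show ?thesis by auto
  next
    case False
    then have pos: "0 < l' - str_exp a \<sigma>" by simp
    show ?thesis
    proof
      fix x assume "x \<in> piece \<sigma>"
      then obtain y where "y \<in> p" "x = str_map f \<sigma> y" by (auto simp: piece_def)
      moreover then obtain \<xi> where \<xi>: "\<xi> \<in> cut (l' - str_exp a \<sigma>)" "y \<in> piece \<xi>"
        using cut_cover pos by blast
      ultimately have "x \<in> piece (\<sigma> @ \<xi>)" by (auto simp: piece_append)
      moreover have "\<sigma> @ \<xi> \<in> cut l'"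
        using cut_append[OF cut_lists[OF assms(3)] pos \<xi>(1)] False by simp
      ultimately show "x \<in> \<Union> (piece ` {\<tau> \<in> cut l'. \<exists>\<xi>. \<tau> = \<sigma> @ \<xi>})" by blast
    qed
  qed
qed

text \<open>A piece with large exponent that contains a given interior point is too small to reach the
  boundary.\<close>

lemma ex_piece_subset_interior:
  "\<exists>\<sigma>\<in>lists {1..N}. \<sigma> \<noteq> [] \<and> piece \<sigma> \<subseteq> interior p"
proof -
  obtain x where x: "x \<in> interior p"
    using polygon_interior_nonempty[OF poly] by blast
  then obtain e where e: "e > 0" "ball x e \<subseteq> interior p"
    using open_interior open_contains_ball by blast
  have "(\<lambda>l. s ^ l * diameter p) \<longlonglongrightarrow> 0 * diameter p"
    using s_pos s_lt_1 by (intro tendsto_intros LIMSEQ_realpow_zero) auto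
  then have "\<forall>\<^sub>F l in sequentially. s ^ l * diameter p < e"
    using e(1) by (simp add: order_tendstoD)
  then obtain l0 where l0: "\<And>l. l \<ge> l0 \<Longrightarrow> s ^ l * diameter p < e"
    by (auto simp: eventually_sequentially)
  obtain \<sigma> where \<sigma>: "\<sigma> \<in> cut (Suc l0)" "x \<in> piece \<sigma>"
    using cut_cover[of x "Suc l0"] x interior_subset by blast
  have "str_exp a \<sigma> \<ge> l0" using \<sigma> by (simp add: cut_def)
  then have "piece \<sigma> \<subseteq> ball x e"
    using piece_dist[OF cut_lists[OF \<sigma>(1)] \<sigma>(2)] l0[of "str_exp a \<sigma>"]
    by (meson mem_ball le_less_trans subsetI)
  then have "piece \<sigma> \<subseteq> interior p" using e(2) by simp
  moreover have "\<sigma> \<noteq> []" using \<sigma>(1) Nil_notin_cut by auto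
  ultimately show ?thesis using cut_lists[OF \<sigma>(1)] by metis
qed

text \<open>Appending \<open>K - 1\<close> further copies of \<open>\<rho>\<close> makes the exponent divisible by \<open>K\<close>. Whether a suffix
  does so depends only on the residue of the exponent of \<open>\<rho>\<close>, so one suffix for each of the finitely
  many residues is enough, which gives a bound independent of \<open>\<rho>\<close>.\<close>

lemma complete_exponent_mod:
  assumes "0 < K"
  shows "\<exists>B. \<forall>\<rho>\<in>lists {1..N}. \<exists>\<xi>\<in>lists {1..N}.
    str_exp a \<xi> \<le> B \<and> K dvd str_exp a \<rho> + str_exp a \<xi>"
proof -
  let ?P = "\<lambda>r \<xi>. \<xi> \<in> lists {1..N} \<and> K dvd r + str_exp a \<xi>"
  let ?rs = "{r. r < K \<and> (\<exists>\<xi>. ?P r \<xi>)}"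
  define c where "c r = (SOME \<xi>. ?P r \<xi>)" for r
  have c: "?P r (c r)" if "r \<in> ?rs" for r
  proof -
    have "\<exists>\<xi>. ?P r \<xi>" using that by simp
    then show ?thesis unfolding c_def by (rule someI_ex)
  qed
  have fin: "finite ?rs" by simp
  show ?thesis
  proof (intro exI ballI)
    fix \<rho> assume \<rho>: "\<rho> \<in> lists {1..N}"
    let ?r = "str_exp a \<rho> mod K"
    have "str_exp a \<rho> + (K - 1) * str_exp a \<rho> = K * str_exp a \<rho>"
      using assms by (cases K) auto
    then have "K dvd str_exp a \<rho> + (K - 1) * str_exp a \<rho>" by simp
    then have "K dvd ?r + (K - 1) * str_exp a \<rho>"
      by (metis dvd_eq_mod_eq_0 mod_add_left_eq)
    moreover have "concat (replicate (K - 1) \<rho>) \<in> lists {1..N}"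
      using \<rho> by (auto simp: in_lists_conv_set)
    ultimately have "?P ?r (concat (replicate (K - 1) \<rho>))" by simp
    then have r: "?r \<in> ?rs" using assms by fastforce
    have "K dvd str_exp a \<rho> + str_exp a (c ?r)"
      using c[OF r] by (metis dvd_eq_mod_eq_0 mod_add_left_eq)
    moreover have "str_exp a (c ?r) \<le> (\<Sum>r\<in>?rs. str_exp a (c r))"
      using r fin by (intro member_le_sum) auto
    ultimately show "\<exists>\<xi>\<in>lists {1..N}. str_exp a \<xi> \<le> (\<Sum>r\<in>?rs. str_exp a (c r)) \<and>
        K dvd str_exp a \<rho> + str_exp a \<xi>"
      using c[OF r] by blast
  qed
qed

text \<open>A tile of one stage reappears at the next one with the new letter of \<open>\<theta>\<close> put in front of
  its string, because the map of that letter cancels against the new inverse map.\<close>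

lemma theta_tiling_upto_mono:
  assumes "\<theta> \<in> streams {1..N}" "1 \<le> k" "k \<le> n"
  shows "theta_tiling_upto p N f a \<theta> k \<subseteq> theta_tiling_upto p N f a \<theta> n"
  using assms(3)
proof (induction n rule: dec_induct)
  case (step n)
  let ?i = "\<theta> !! n" and ?L = "str_exp a (stake n \<theta>)"
  have i: "?i \<in> {1..N}" using assms(1) by (auto simp: streams_iff_snth)
  have "1 \<le> length (stake n \<theta>)" "set (stake n \<theta>) \<subseteq> {1..N}"
    using step assms by (auto simp: streams_iff_snth stake_nth in_set_conv_nth)
  then have L: "0 < ?L" using a_pos by (cases "stake n \<theta>") auto
  have up: "theta_tiling_upto p N f a \<theta> m = tile p f \<theta> m ` cut (str_exp a (stake m \<theta>))" for m
    by (auto simp: theta_tiling_upto_def cut_def)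
  have "tile p f \<theta> n \<sigma> \<in> tile p f \<theta> (Suc n) ` cut (str_exp a (stake (Suc n) \<theta>))"
    if \<sigma>: "\<sigma> \<in> cut ?L" for \<sigma>
  proof
    show "?i # \<sigma> \<in> cut (str_exp a (stake (Suc n) \<theta>))"
      using cut_append[of "[?i]" ?L \<sigma>] i L \<sigma> by (simp add: stake_Suc add.commute del: stake.simps)
    have "inv (f ?i) \<circ> f ?i = id"
      using sim[OF i] similitude_bij bij_is_inj inv_o_cancel by blast
    then have "str_map_neg f (stake (Suc n) \<theta>) \<circ> str_map f (?i # \<sigma>) =
        str_map_neg f (stake n \<theta>) \<circ> str_map f \<sigma>"
      by (simp add: stake_Suc fun_eq_iff del: stake.simps)
    then show "tile p f \<theta> n \<sigma> = tile p f \<theta> (Suc n) (?i # \<sigma>)" by (simp only: tile_def)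
  qed
  then show ?case using step.IH by (auto simp: up)
qed simp

end

section \<open>Tilings of the plane from expanding periodic strings\<close>

text \<open>The condition \<open>v_int\<close> puts the fixed point of the contraction \<open>str_map f v\<close> into the interior
  of \<open>p\<close>, so that the images of \<open>p\<close> under the powers of its inverse exhaust the plane.\<close>

locale expanding_string = self_similar_polygon +
  fixes v :: "nat list"
  assumes v_in: "v \<in> lists {1..N}" and v_ne: "v \<noteq> []" and v_int: "piece v \<subseteq> interior p"
begin

abbreviation K where "K \<equiv> str_exp a v"
abbreviation g where "g \<equiv> str_map f v"
abbreviation h where "h \<equiv> inv g"
abbreviation \<T> where "\<T> \<equiv> theta_tiling p N f a (cycle (rev v))"

text \<open>The tiles present after \<open>m\<close> periods of the string \<open>cycle (rev v)\<close>; see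
  \<open>theta_tiling_upto_period\<close>.\<close>

definition level :: "nat \<Rightarrow> plane set set" where
  "level m = (\<lambda>\<sigma>. (h ^^ m) ` piece \<sigma>) ` cut (m * K)"

lemma K_pos: "0 < K"
  using v_in v_ne a_pos by (cases v) auto

lemma g_sim: "similitude (s ^ K) g" using str_map_similitude v_in by blast

lemma h_g: "h (g x) = x" using similitude_bij[OF g_sim] by (simp add: bij_is_inj)
lemma g_h: "g (h x) = x" using similitude_bij[OF g_sim] by (simp add: bij_is_surj surj_f_inv_f)

lemma hm_gm: "(h ^^ m) ((g ^^ m) x) = x"
  by (induction m arbitrary: x) (auto simp: h_g funpow_swap1)

lemma gm_hm: "(g ^^ m) ((h ^^ m) x) = x"
  by (induction m arbitrary: x) (auto simp: g_h funpow_swap1)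

lemma hm_sim: "similitude (1 / s ^ (m * K)) (h ^^ m)"
  using similitude_funpow[OF similitude_inv[OF g_sim], of m]
  by (simp add: power_one_over power_mult[symmetric] mult.commute)

lemma gm_sim: "similitude (s ^ (m * K)) (g ^^ m)"
  using similitude_funpow[OF g_sim, of m] by (simp add: power_mult[symmetric] mult.commute)

lemma tile_sim:
  "\<sigma> \<in> lists {1..N} \<Longrightarrow> similitude (s ^ str_exp a \<sigma> / s ^ (m * K)) ((h ^^ m) \<circ> str_map f \<sigma>)"
  using similitude_compose[OF hm_sim str_map_similitude] by simp

lemma hm_piece: "(h ^^ m) ` piece \<sigma> = ((h ^^ m) \<circ> str_map f \<sigma>) ` p"
  by (simp add: piece_def image_comp)

lemma theta_in: "cycle (rev v) \<in> streams {1..N}"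
  using v_in v_ne by (auto simp: streams_iff_sset)

lemma theta_tiling_upto_period: "theta_tiling_upto p N f a (cycle (rev v)) (m * length v) = level m"
proof -
  have st: "stake (m * length v) (cycle (rev v)) = concat (replicate m (rev v))"
    using v_ne by simp
  have "str_map_neg f (concat (replicate m (rev v))) = h ^^ m"
    using v_in by (simp add: str_map_neg_concat_replicate str_map_neg_rev)
  then show ?thesis
    by (auto simp: theta_tiling_upto_def level_def tile_def cut_def st hm_piece)
qed

lemma level_mono: "1 \<le> m \<Longrightarrow> m \<le> n \<Longrightarrow> level m \<subseteq> level n"
  using theta_tiling_upto_mono[OF theta_in, of "m * length v" "n * length v"] v_ne
  by (simp add: theta_tiling_upto_period Suc_le_eq)

lemma tiling_eq: "\<T> = (\<Union>m\<in>{1..}. level m)"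
proof
  show "\<T> \<subseteq> (\<Union>m\<in>{1..}. level m)"
  proof
    fix t assume "t \<in> \<T>"
    then obtain k where k: "1 \<le> k" "t \<in> theta_tiling_upto p N f a (cycle (rev v)) k"
      by (auto simp: theta_tiling_def)
    moreover have "k \<le> k * length v" using v_ne by (cases v) auto
    ultimately have "t \<in> level k"
      using theta_tiling_upto_mono[OF theta_in, of k "k * length v"]
      by (auto simp: theta_tiling_upto_period)
    then show "t \<in> (\<Union>m\<in>{1..}. level m)" using k by auto
  qed
  show "(\<Union>m\<in>{1..}. level m) \<subseteq> \<T>"
    unfolding theta_tiling_def theta_tiling_upto_period[symmetric]
    using v_ne by (auto simp: Suc_le_eq intro!: bexI)
qed

lemma tilingE:
  assumes "t \<in> \<T>"
  obtains m \<sigma> where "1 \<le> m" "\<sigma> \<in> cut (m * K)" "t = (h ^^ m) ` piece \<sigma>"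
  using assms by (auto simp: tiling_eq level_def)

lemma level_subset_tiling: "1 \<le> m \<Longrightarrow> level m \<subseteq> \<T>"
  by (auto simp: tiling_eq)

lemma level_union: "1 \<le> m \<Longrightarrow> x \<in> (h ^^ m) ` p \<Longrightarrow> \<exists>t\<in>level m. x \<in> t"
  using cut_cover[of _ "m * K"] K_pos by (fastforce simp: level_def)

text \<open>The contraction \<open>g\<close> maps \<open>p\<close> into its interior, so its fixed point has a ball around it
  inside \<open>p\<close>, and \<open>g ^^ m\<close> moves a given bounded set into this ball for all large \<open>m\<close>.\<close>

lemma bounded_subset_blowup:
  assumes "bounded S"
  shows "\<exists>M. \<forall>m\<ge>M. S \<subseteq> (h ^^ m) ` p"
proof -
  have "\<exists>!x\<in>p. g x = x"
  proof (rule Banach_fix[where c = "s ^ K"])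
    show "complete p" using compact_p by (rule compact_imp_complete)
    show "p \<noteq> {}" using poly by (auto simp: polygon_def)
    show "g ` p \<subseteq> p" using str_map_image_subset v_in by blast
    show "0 \<le> s ^ K" "s ^ K < 1"
      using s_pos s_lt_1 K_pos by (auto simp: power_less_one_iff)
    show "\<And>x y. x \<in> p \<Longrightarrow> y \<in> p \<Longrightarrow> dist (g x) (g y) \<le> s ^ K * dist x y"
      using g_sim by (simp add: similitude_def)
  qed
  then obtain c where c: "c \<in> p" "g c = c" by blast
  then have "c \<in> interior p" using v_int by (force simp: piece_def)
  then obtain e where e: "e > 0" "ball c e \<subseteq> p"
    using mem_interior by blast
  obtain D where D: "\<And>x. x \<in> S \<Longrightarrow> dist c x \<le> D"
    using assms unfolding bounded_any_center[where a = c] by blast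
  have "(\<lambda>m. (s ^ K) ^ m * D) \<longlonglongrightarrow> 0 * D"
    using s_pos s_lt_1 K_pos by (intro tendsto_intros LIMSEQ_realpow_zero) (auto simp: power_less_one_iff)
  then have "\<forall>\<^sub>F m in sequentially. (s ^ K) ^ m * D < e"
    using e(1) by (simp add: order_tendstoD)
  then obtain M where M: "\<And>m. m \<ge> M \<Longrightarrow> (s ^ K) ^ m * D < e"
    by (auto simp: eventually_sequentially)
  have "x \<in> (h ^^ m) ` p" if "x \<in> S" "m \<ge> M" for x m
  proof -
    have "(g ^^ m) c = c" by (induction m) (auto simp: c)
    then have "dist c ((g ^^ m) x) = (s ^ K) ^ m * dist c x"
      using similitude_funpow[OF g_sim, of m] by (metis similitude_def)
    also have "\<dots> \<le> (s ^ K) ^ m * D"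
      using D[OF that(1)] s_pos by (intro mult_left_mono) auto
    also have "\<dots> < e" using M that by blast
    finally have "(g ^^ m) x \<in> p" using e by auto
    then show ?thesis using hm_gm by (metis image_eqI)
  qed
  then show ?thesis by blast
qed

lemma tiling_pairwise: "pairwise bdry_disjnt \<T>"
proof (rule pairwiseI)
  fix t u assume tu: "t \<in> \<T>" "u \<in> \<T>" "t \<noteq> u"
  then obtain m n where mn: "1 \<le> m" "1 \<le> n" "t \<in> level m" "u \<in> level n"
    by (auto simp: tiling_eq)
  then have "t \<in> level (max m n)" "u \<in> level (max m n)"
    using level_mono[of m "max m n"] level_mono[of n "max m n"] by auto
  then obtain \<sigma> \<tau> where st: "\<sigma> \<in> cut (max m n * K)" "\<tau> \<in> cut (max m n * K)"
      "t = (h ^^ max m n) ` piece \<sigma>" "u = (h ^^ max m n) ` piece \<tau>"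
    by (auto simp: level_def)
  moreover have "0 < max m n * K" using mn K_pos by simp
  ultimately have "bdry_disjnt (piece \<sigma>) (piece \<tau>)"
    using tu by (intro cut_bdry_disjnt) auto
  then show "bdry_disjnt t u" using st bdry_disjnt_image hm_sim by blast
qed

text \<open>The number \<open>d\<close> is the excess of the exponent of the tile over the cut level. That it is a bounded
  natural number is what makes the tiling of finite order.\<close>

lemma tile_image:
  assumes "t \<in> \<T>"
  obtains d j where "d \<le> (\<Sum>n\<in>{1..N}. a n)" "similitude (s ^ d) j" "t = j ` p"
proof -
  obtain m \<sigma> where m: "1 \<le> m" "\<sigma> \<in> cut (m * K)" "t = (h ^^ m) ` piece \<sigma>"
    using assms by (rule tilingE)
  show ?thesis
  proof
    have le: "m * K \<le> str_exp a \<sigma>" using m by (simp add: cut_def)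
    show "str_exp a \<sigma> - m * K \<le> (\<Sum>n\<in>{1..N}. a n)"
      using cut_str_exp_less[OF m(2)] m(1) K_pos by simp
    show "similitude (s ^ (str_exp a \<sigma> - m * K)) ((h ^^ m) \<circ> str_map f \<sigma>)"
      using tile_sim[OF cut_lists[OF m(2)], of m] le s_pos by (simp add: power_diff)
    show "t = ((h ^^ m) \<circ> str_map f \<sigma>) ` p" using m hm_piece by simp
  qed
qed

lemma tiling_polygon: "t \<in> \<T> \<Longrightarrow> polygon t"
  by (metis tile_image polygon_similitude_image poly)

lemma similitude_between_images:
  assumes "similitude q i" "similitude r j"
  shows "similitude (r / q) (j \<circ> inv i)" "(j \<circ> inv i) ` i ` p = j ` p"
proof -
  show "similitude (r / q) (j \<circ> inv i)"
    using similitude_compose[OF assms(2) similitude_inv[OF assms(1)]] by simp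
  show "(j \<circ> inv i) ` i ` p = j ` p"
    using bij_is_inj[OF similitude_bij[OF assms(1)]] by (simp add: image_image)
qed

lemma tiling_similar: "t \<in> \<T> \<Longrightarrow> u \<in> \<T> \<Longrightarrow> similar_sets t u"
  unfolding similar_sets_def by (metis tile_image similitude_between_images)

lemma tiling_plane: "plane_tiling \<T>"
  unfolding plane_tiling_def
proof (intro conjI ballI)
  show "compact t" if "t \<in> \<T>" for t
    using tiling_polygon[OF that] by (simp add: polygon_def)
  show "\<Union>\<T> = UNIV"
  proof -
    have "x \<in> \<Union>\<T>" for x
    proof -
      obtain M where "\<forall>m\<ge>M. {x} \<subseteq> (h ^^ m) ` p"
        using bounded_subset_blowup[of "{x}"] by auto
      then have "x \<in> (h ^^ Suc M) ` p" using le_Suc_eq by blast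
      then show ?thesis
        using level_union[of "Suc M" x] level_subset_tiling[of "Suc M"] by auto
    qed
    then show ?thesis by blast
  qed
qed (fact tiling_pairwise)

text \<open>The map \<open>h\<close> carries a tile of level \<open>m\<close> to a piece of the dissection of \<open>(h ^^ Suc m) ` p\<close> at
  exponent \<open>m * K\<close>, which the dissection at exponent \<open>Suc m * K\<close> refines.\<close>

lemma tiling_self_similar: "self_similar \<T>"
  unfolding self_similar_def
proof (rule exI[of _ "1 / s ^ K"], rule exI[of _ h], intro conjI ballI)
  show "1 < 1 / s ^ K"
    using s_pos s_lt_1 K_pos by (simp add: power_less_one_iff)
  show "similitude (1 / s ^ K) h" using similitude_inv[OF g_sim] .
  fix t assume "t \<in> \<T>"
  then obtain m \<sigma> where m: "1 \<le> m" "\<sigma> \<in> cut (m * K)" "t = (h ^^ m) ` piece \<sigma>"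
    by (rule tilingE)
  let ?C = "{\<tau> \<in> cut (Suc m * K). \<exists>\<xi>. \<tau> = \<sigma> @ \<xi>}"
  let ?S = "(\<lambda>\<tau>. (h ^^ Suc m) ` piece \<tau>) ` ?C"
  have "?S \<subseteq> level (Suc m)" unfolding level_def by blast
  then have sub: "?S \<subseteq> \<T>" using level_subset_tiling[of "Suc m"] by simp
  have "0 < m * K" using m K_pos by simp
  then have "piece \<sigma> = \<Union> (piece ` ?C)" using m(2) by (intro piece_refine) auto
  then have "(h ^^ Suc m) ` piece \<sigma> = (h ^^ Suc m) ` \<Union> (piece ` ?C)" by simp
  also have "\<dots> = \<Union>?S" by (simp only: image_UN)
  finally have "h ` t = \<Union>?S" using m by (simp add: image_comp)
  then show "\<exists>S. S \<subseteq> \<T> \<and> pairwise bdry_disjnt S \<and> h ` t = \<Union> S"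
    using sub pairwise_subset[OF tiling_pairwise sub] by blast
qed

text \<open>Two tiles with the same excess \<open>d\<close> are images of \<open>p\<close> under similitudes of the same ratio, hence
  congruent, so each congruence class is determined by some \<open>d\<close>.\<close>

lemma tiling_finite_order: "finite_order \<T>"
  unfolding finite_order_def
proof (rule finite_subset)
  let ?R = "{(t, u). t \<in> \<T> \<and> u \<in> \<T> \<and> congruent_sets t u}"
  let ?c = "\<lambda>d. {u \<in> \<T>. \<exists>j. similitude (s ^ d) j \<and> u = j ` p}"
  let ?A = "\<Sum>n\<in>{1..N}. a n"
  show "finite (?c ` {..?A})" by simp
  show "\<T> // ?R \<subseteq> ?c ` {..?A}"
  proof
    fix X assume "X \<in> \<T> // ?R"
    then obtain t where t: "t \<in> \<T>" "X = ?R `` {t}" by (auto simp: quotient_def)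
    obtain d j where j: "d \<le> ?A" "similitude (s ^ d) j" "t = j ` p"
      using t(1) by (rule tile_image)
    have "congruent_sets t u \<longleftrightarrow> (\<exists>i. similitude (s ^ d) i \<and> u = i ` p)" for u
    proof
      assume "congruent_sets t u"
      then obtain k where k: "similitude 1 k" "u = k ` t" by (auto simp: congruent_sets_def)
      then have "similitude (s ^ d) (k \<circ> j)" "u = (k \<circ> j) ` p"
        using similitude_compose[OF k(1) j(2)] j(3) by (auto simp: image_comp)
      then show "\<exists>i. similitude (s ^ d) i \<and> u = i ` p" by blast
    next
      assume "\<exists>i. similitude (s ^ d) i \<and> u = i ` p"
      then obtain i where i: "similitude (s ^ d) i" "u = i ` p" by blast
      show "congruent_sets t u"
        using similitude_between_images[OF j(2) i(1)] s_pos j(3) i(2)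
        by (auto simp: congruent_sets_def intro!: exI[of _ "i \<circ> inv j"])
    qed
    then have "X = ?c d" using t by auto
    then show "X \<in> ?c ` {..?A}" using j by blast
  qed
qed

text \<open>Some level covers the union of \<open>U\<close>. An interior point of a tile in \<open>U\<close> then lies in a tile of
  that level as well, and since distinct tiles share only boundary points, the two tiles coincide.\<close>

lemma bounded_subset_level:
  assumes "U \<subseteq> \<T>" "bounded (\<Union>U)"
  shows "\<exists>m\<ge>1. U \<subseteq> level m"
proof -
  obtain M where M: "\<forall>m\<ge>M. \<Union>U \<subseteq> (h ^^ m) ` p"
    using bounded_subset_blowup[OF assms(2)] by blast
  have "t \<in> level (Suc M)" if t: "t \<in> U" for t
  proof -
    obtain x where x: "x \<in> interior t"
      using t assms tiling_polygon polygon_interior_nonempty by blast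
    then have xt: "x \<in> t" using interior_subset by blast
    then have "x \<in> (h ^^ Suc M) ` p" using M[rule_format, of "Suc M"] t by auto
    then obtain u where u: "u \<in> level (Suc M)" "x \<in> u"
      using level_union[of "Suc M" x] by auto
    have "t = u"
    proof (rule ccontr)
      assume "t \<noteq> u"
      moreover have "u \<in> \<T>" using u level_subset_tiling[of "Suc M"] by auto
      ultimately have "bdry_disjnt t u"
        using t assms tiling_pairwise by (auto simp: pairwise_def)
      then have "x \<in> frontier t" using u xt by (auto simp: bdry_disjnt_def)
      then show False using x by (simp add: frontier_def)
    qed
    then show ?thesis using u by simp
  qed
  then show ?thesis by (intro exI[of _ "Suc M"]) auto
qed

text \<open>The copy of level \<open>m\<close> near \<open>x\<close> is found inside a level \<open>n\<close> whose union contains \<open>x\<close>: it is the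
  dissection of \<open>(h ^^ n) ` piece \<sigma>\<close> for a string \<open>\<sigma>\<close> of exponent exactly \<open>(n - m) * K\<close>. The string
  starts with some \<open>\<rho>\<close> such that \<open>(h ^^ n) ` piece \<rho>\<close> contains \<open>x\<close> and has a diameter bounded
  independently of \<open>x\<close> and \<open>n\<close>.\<close>

lemma level_recurrence:
  assumes "1 \<le> m"
  shows "\<exists>R>0. \<forall>x. \<exists>j. similitude 1 j \<and> (\<forall>t\<in>level m. j ` t \<in> \<T> \<and> j ` t \<subseteq> cball x R)"
proof -
  obtain B where B: "\<forall>\<rho>\<in>lists {1..N}. \<exists>\<xi>\<in>lists {1..N}.
      str_exp a \<xi> \<le> B \<and> K dvd str_exp a \<rho> + str_exp a \<xi>"
    using complete_exponent_mod[OF K_pos] by blast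
  define A where "A = (\<Sum>n\<in>{1..N}. a n)"
  \<comment> \<open>The string \<open>\<rho>\<close> is cut at exponent \<open>n * K - w\<close>. It may overshoot by \<open>A\<close>, the correcting suffix
    needs at most \<open>B\<close>, and \<open>m * K\<close> must be left for the copy of level \<open>m\<close>.\<close>
  define w where "w = m * K + B + A"
  define R where "R = diameter p / s ^ w + 1"
  have "0 \<le> diameter p" using compact_p by (simp add: diameter_ge_0 compact_imp_bounded)
  then have "R > 0" using s_pos by (simp add: R_def add_nonneg_pos)
  moreover have "\<exists>j. similitude 1 j \<and> (\<forall>t\<in>level m. j ` t \<in> \<T> \<and> j ` t \<subseteq> cball x R)" for x
  proof -
    obtain M where M: "\<forall>n\<ge>M. {x} \<subseteq> (h ^^ n) ` p"
      using bounded_subset_blowup[of "{x}"] by auto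
    define n where "n = M + w + 1"
    define l where "l = n * K - w"
    have "n \<le> n * K" using K_pos by simp
    then have l: "0 < l" "n * K = l + w" by (auto simp: l_def n_def)
    have "m \<le> m * K" using K_pos by simp
    then have mn: "m \<le> n"
      unfolding n_def w_def by linarith
    have "M \<le> n" by (simp add: n_def)
    then have "x \<in> (h ^^ n) ` p" using M by blast
    then obtain y where y: "y \<in> p" "x = (h ^^ n) y" by blast
    obtain \<rho> where \<rho>: "\<rho> \<in> cut l" "y \<in> piece \<rho>"
      using cut_cover[OF y(1) l(1)] by blast
    note \<rho>l = cut_lists[OF \<rho>(1)]
    obtain \<xi> where \<xi>: "\<xi> \<in> lists {1..N}" "str_exp a \<xi> \<le> B" "K dvd str_exp a \<rho> + str_exp a \<xi>"
      using B \<rho>l by blast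
    have "str_exp a \<rho> + str_exp a \<xi> \<le> l + A + B"
      using cut_str_exp_less[OF \<rho>(1) l(1)] \<xi>(2) by (simp add: A_def)
    also have "\<dots> = (n - m) * K" using l(2) by (simp add: w_def diff_mult_distrib)
    finally have le: "str_exp a \<rho> + str_exp a \<xi> \<le> (n - m) * K" .
    have "K dvd (n - m) * K - (str_exp a \<rho> + str_exp a \<xi>)"
      using \<xi>(3) by (intro dvd_diff_nat) auto
    then obtain q where q: "(n - m) * K - (str_exp a \<rho> + str_exp a \<xi>) = q * K"
      by (metis dvdE mult.commute)
    define \<zeta> where "\<zeta> = \<xi> @ concat (replicate q v)"
    define \<sigma> where "\<sigma> = \<rho> @ \<zeta>"
    have \<zeta>: "\<zeta> \<in> lists {1..N}"
      using \<xi>(1) v_in by (auto simp: \<zeta>_def in_lists_conv_set)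
    then have \<sigma>: "\<sigma> \<in> lists {1..N}" using \<rho>l by (simp add: \<sigma>_def)
    have e\<sigma>: "str_exp a \<sigma> = (n - m) * K"
      using q le by (simp add: \<sigma>_def \<zeta>_def)
    have e\<sigma>m: "str_exp a \<sigma> + m * K = n * K"
      using mn by (simp add: e\<sigma> add_mult_distrib[symmetric])
    define j where "j = (h ^^ n) \<circ> str_map f \<sigma> \<circ> (g ^^ m)"
    have "similitude (s ^ str_exp a \<sigma> / s ^ (n * K) * s ^ (m * K)) j"
      unfolding j_def by (rule similitude_compose[OF tile_sim[OF \<sigma>] gm_sim])
    moreover have "s ^ str_exp a \<sigma> / s ^ (n * K) * s ^ (m * K) = 1"
      using s_pos by (simp add: e\<sigma>m[symmetric] power_add)
    ultimately have j1: "similitude 1 j" by (simp only:)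
    have "j ` t \<in> \<T> \<and> j ` t \<subseteq> cball x R" if t: "t \<in> level m" for t
    proof
      obtain \<tau> where \<tau>: "\<tau> \<in> cut (m * K)" "t = (h ^^ m) ` piece \<tau>"
        using t by (auto simp: level_def)
      have jt: "j ` t = (h ^^ n) ` piece (\<sigma> @ \<tau>)"
        unfolding j_def \<tau>(2) piece_append image_comp
        by (simp add: image_image gm_hm)
      have "\<sigma> @ \<tau> \<in> cut (n * K)"
        using cut_append[OF \<sigma> _ \<tau>(1)] assms K_pos by (simp add: e\<sigma>m)
      then have "j ` t \<in> level n" using jt by (auto simp: level_def)
      then show "j ` t \<in> \<T>" using level_subset_tiling[of n] assms mn by auto
      have "piece (\<sigma> @ \<tau>) \<subseteq> piece \<rho>"
        using piece_append_subset[of "\<zeta> @ \<tau>" \<rho>] \<zeta> cut_lists[OF \<tau>(1)] by (simp add: \<sigma>_def)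
      then have sub: "j ` t \<subseteq> (h ^^ n) ` piece \<rho>" unfolding jt by (rule image_mono)
      show "j ` t \<subseteq> cball x R"
      proof
        fix z assume "z \<in> j ` t"
        then obtain y' where y': "y' \<in> piece \<rho>" "z = (h ^^ n) y'" using sub by blast
        have "dist y y' \<le> s ^ str_exp a \<rho> * diameter p"
          using piece_dist[OF \<rho>l \<rho>(2) y'(1)] .
        also have "\<dots> \<le> s ^ l * diameter p"
          using \<rho>(1) s_pos s_lt_1 \<open>0 \<le> diameter p\<close>
          by (intro mult_right_mono power_decreasing) (auto simp: cut_def)
        finally have "dist y y' / s ^ (n * K) \<le> s ^ l * diameter p / s ^ (n * K)"
          using s_pos by (intro divide_right_mono) auto
        also have "\<dots> = diameter p / s ^ w"
          using s_pos by (simp add: l(2) power_add)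
        also have "dist y y' / s ^ (n * K) = dist x z"
          using hm_sim[of n] y y' by (simp add: similitude_def)
        finally show "z \<in> cball x R" by (simp add: R_def)
      qed
    qed
    then show ?thesis using j1 by blast
  qed
  ultimately show ?thesis by blast
qed

lemma tiling_quasiperiodic: "quasiperiodic \<T>"
  unfolding quasiperiodic_def
proof (intro allI impI)
  fix U assume "patch \<T> U"
  then have U: "U \<subseteq> \<T>" "\<Union>U homeomorphic cball (0 :: plane) 1"
    by (auto simp: patch_def)
  have "compact (\<Union>U)" using homeomorphic_compactness[OF U(2)] by simp
  then obtain m where m: "1 \<le> m" "U \<subseteq> level m"
    using bounded_subset_level[OF U(1)] compact_imp_bounded by blast
  obtain R where R: "R > 0"
      "\<And>x. \<exists>j. similitude 1 j \<and> (\<forall>t\<in>level m. j ` t \<in> \<T> \<and> j ` t \<subseteq> cball x R)"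
    using level_recurrence[OF m(1)] by blast
  show "\<exists>R>0. \<forall>x. \<exists>g. similitude 1 g \<and> (\<lambda>t. g ` t) ` U \<subseteq> \<T> \<and> (\<forall>t\<in>U. g ` t \<subseteq> cball x R)"
  proof (rule exI[of _ R], intro conjI allI)
    show "R > 0" by fact
    fix x
    obtain j where "similitude 1 j" "\<forall>t\<in>level m. j ` t \<in> \<T> \<and> j ` t \<subseteq> cball x R"
      using R(2) by blast
    then show "\<exists>g. similitude 1 g \<and> (\<lambda>t. g ` t) ` U \<subseteq> \<T> \<and> (\<forall>t\<in>U. g ` t \<subseteq> cball x R)"
      using m(2) by (intro exI[of _ j]) auto
  qed
qed

theorem self_similar_polygonal_tiling: "self_similar_polygonal_tiling \<T>"
  unfolding self_similar_polygonal_tiling_def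
  using tiling_plane tiling_polygon tiling_similar tiling_self_similar tiling_quasiperiodic
    tiling_finite_order by blast

end

section \<open>Infinitely many strings\<close>

theorem theorem4p1:
  fixes p :: "plane set" and N :: nat and f :: "nat \<Rightarrow> plane \<Rightarrow> plane"
    and s :: real and a :: "nat \<Rightarrow> nat"
  assumes "generating_pair p N f s a"
  shows "infinite {\<theta> \<in> streams {1..N}. self_similar_polygonal_tiling (theta_tiling p N f a \<theta>)}"
proof -
  interpret self_similar_polygon p N f s a by unfold_locales fact
  obtain \<sigma> where \<sigma>: "\<sigma> \<in> lists {1..N}" "piece \<sigma> \<subseteq> interior p"
    using ex_piece_subset_interior by blast
  \<comment> \<open>The reversal of \<open>v n\<close> starts with \<open>n\<close> ones and a two, so different \<open>n\<close> give different
    periodic strings.\<close>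
  define v where "v n = \<sigma> @ 2 # replicate n 1" for n :: nat
  have "expanding_string p N f s a (v n)" for n
  proof unfold_locales
    show "v n \<in> lists {1..N}" using \<sigma>(1) N_ge by (auto simp: v_def in_lists_conv_set)
    show "v n \<noteq> []" by (simp add: v_def)
    have "piece (v n) \<subseteq> piece \<sigma>"
      unfolding v_def using N_ge by (intro piece_append_subset) (auto simp: in_lists_conv_set)
    then show "piece (v n) \<subseteq> interior p" using \<sigma>(2) by blast
  qed
  then have sub: "range (\<lambda>n. cycle (rev (v n))) \<subseteq>
      {\<theta> \<in> streams {1..N}. self_similar_polygonal_tiling (theta_tiling p N f a \<theta>)}"
    using expanding_string.self_similar_polygonal_tiling expanding_string.theta_in by blast
  have snth: "cycle (rev (v n)) !! k = (if k < n then 1 else 2)" if "k \<le> n" for n k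
  proof -
    have "cycle (rev (v n)) = rev (v n) @- cycle (rev (v n))"
      by (rule cycle_decomp) (simp add: v_def)
    moreover have "rev (v n) = replicate n 1 @ 2 # rev \<sigma>" by (simp add: v_def)
    ultimately show ?thesis
      using that by (metis (no_types, lifting) shift_snth nth_append nth_append_length
          length_replicate nth_replicate length_append length_Cons le_neq_implies_less
          add_Suc_right less_add_Suc1 trans_less_add1)
  qed
  have "inj (\<lambda>n. cycle (rev (v n)))"
  proof (rule linorder_injI)
    fix n n' :: nat assume "n < n'"
    then have "cycle (rev (v n)) !! n \<noteq> cycle (rev (v n')) !! n" by (simp add: snth)
    then show "cycle (rev (v n)) \<noteq> cycle (rev (v n'))" by metis
  qed
  then show ?thesis using sub range_inj_infinite infinite_super by blast
qed

end
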